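(* Let $k,l,m,n>0$ satisfy $k+m<1$ and $l+n<1$. For every $q\in\mathbb C\setminus\{0,1\}$, the function $$p\mapsto\log\frac{|p-q|}{|p|^{k}|q|^{l}|p-1|^{m}|q-1|^{n}},\qquad p\in\mathbb C\setminus\{0,1\},\ p\ne q,$$ is an Evans-Selberg potential on $\mathbb C\setminus\{0,1\}$ with pole $q$.
   Context: Let $\Sigma$ be an open Riemann surface and $q\in\Sigma$. An Evans-Selberg potential on $\Sigma$ with pole $q$ is a real-valued function $E_q(p)$ such that: (i) $E_q(p)$ is harmonic in $p$ on $\Sigma\setminus\{q\}$; (ii) $E_q(p)-\log|\varphi(p)-\varphi(q)|$ is bounded near $q$, where $\varphi$ is a local coordinate; (iii) $E_q(p)\to+\infty$ as $p\to a_\infty$, the Alexandroff ideal boundary point of $\Sigma$ (i.e. the point at infinity of the one-point compactification of $\Sigma$). *)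

theory Defs
  imports "HOL-Complex_Analysis.Complex_Analysis"
begin

section \<open>Harmonic functions on plane open sets\<close>

definition has_partials_on ::
    "(complex \<Rightarrow> real) \<Rightarrow> (complex \<Rightarrow> real) \<Rightarrow> (complex \<Rightarrow> real) \<Rightarrow> complex set \<Rightarrow> bool" where
  "has_partials_on f fx fy S \<longleftrightarrow>
     (\<forall>z\<in>S. ((\<lambda>t. f (z + complex_of_real t)) has_real_derivative fx z) (at 0) \<and>
            ((\<lambda>t. f (z + \<i> * complex_of_real t)) has_real_derivative fy z) (at 0))"

text \<open>
  Twice continuously differentiable with vanishing Laplacian. Continuity is only demanded of the
  second partial derivatives; on an open set that of the function and of its first partial
  derivatives follows.
\<close>
definition plane_harmonic_on :: "(complex \<Rightarrow> real) \<Rightarrow> complex set \<Rightarrow> bool" where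
  "plane_harmonic_on f S \<longleftrightarrow> open S \<and>
     (\<exists>fx fy fxx fxy fyx fyy.
        has_partials_on f fx fy S \<and>
        has_partials_on fx fxx fxy S \<and> has_partials_on fy fyx fyy S \<and>
        continuous_on S fxx \<and> continuous_on S fxy \<and>
        continuous_on S fyx \<and> continuous_on S fyy \<and>
        (\<forall>z\<in>S. fxx z + fyy z = 0))"

section \<open>Riemann surfaces\<close>

text \<open>
  A chart is a pair of a domain and a map. The map is a total function; its values off the domain
  are irrelevant.
\<close>
type_synonym 'a chart = "'a set \<times> ('a \<Rightarrow> complex)"

definition is_chart :: "'a topology \<Rightarrow> 'a chart \<Rightarrow> bool" where
  "is_chart X = (\<lambda>(U, \<phi>). openin X U \<and> open (\<phi> ` U) \<and>
     homeomorphic_map (subtopology X U) (top_of_set (\<phi> ` U)) \<phi>)"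

definition compatible_charts :: "'a chart \<Rightarrow> 'a chart \<Rightarrow> bool" where
  "compatible_charts = (\<lambda>(U, \<phi>) (V, \<psi>).
     (\<psi> \<circ> the_inv_into U \<phi>) holomorphic_on \<phi> ` (U \<inter> V) \<and>
     (\<phi> \<circ> the_inv_into V \<psi>) holomorphic_on \<psi> ` (U \<inter> V))"

definition holomorphic_atlas :: "'a topology \<Rightarrow> 'a chart set \<Rightarrow> bool" where
  "holomorphic_atlas X A \<longleftrightarrow>
     (\<forall>c\<in>A. is_chart X c) \<and> \<Union> (fst ` A) = topspace X \<and>
     (\<forall>c\<in>A. \<forall>d\<in>A. compatible_charts c d)"

text \<open>
  Second countability is not required: by Rado's theorem it is automatic.
\<close>
definition riemann_surface :: "'a topology \<Rightarrow> 'a chart set \<Rightarrow> bool" where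
  "riemann_surface X A \<longleftrightarrow>
     topspace X \<noteq> {} \<and> connected_space X \<and> Hausdorff_space X \<and> holomorphic_atlas X A"

definition open_riemann_surface :: "'a topology \<Rightarrow> 'a chart set \<Rightarrow> bool" where
  "open_riemann_surface X A \<longleftrightarrow> riemann_surface X A \<and> \<not> compact_space X"

text \<open>
  The local coordinates are the members of the maximal atlas generated by the given one.
\<close>
definition local_coordinate :: "'a topology \<Rightarrow> 'a chart set \<Rightarrow> 'a chart \<Rightarrow> bool" where
  "local_coordinate X A c \<longleftrightarrow> is_chart X c \<and> (\<forall>d\<in>A. compatible_charts c d)"

definition surface_harmonic_on ::
    "'a topology \<Rightarrow> 'a chart set \<Rightarrow> ('a \<Rightarrow> real) \<Rightarrow> 'a set \<Rightarrow> bool" where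
  "surface_harmonic_on X A f W \<longleftrightarrow> openin X W \<and>
     (\<forall>U \<phi>. local_coordinate X A (U, \<phi>) \<longrightarrow>
        plane_harmonic_on (f \<circ> the_inv_into U \<phi>) (\<phi> ` (U \<inter> W)))"

section \<open>Evans--Selberg potentials\<close>

text \<open>
  The value of \<open>E\<close> at the pole \<open>q\<close> plays no role: harmonicity is on the complement of \<open>q\<close>, and the
  filter \<open>atin X q\<close> consists of punctured neighbourhoods. In the Alexandroff compactification, of
  type \<open>'a option\<close>, the point at infinity is \<open>None\<close>, and \<open>the\<close> identifies the remaining points with
  those of the surface.
\<close>
definition evans_selberg_potential ::
    "'a topology \<Rightarrow> 'a chart set \<Rightarrow> 'a \<Rightarrow> ('a \<Rightarrow> real) \<Rightarrow> bool" where
  "evans_selberg_potential X A q E \<longleftrightarrow>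
     open_riemann_surface X A \<and> q \<in> topspace X \<and>
     surface_harmonic_on X A E (topspace X - {q}) \<and>
     (\<forall>U \<phi>. local_coordinate X A (U, \<phi>) \<and> q \<in> U \<longrightarrow>
        Bfun (\<lambda>p. E p - ln (cmod (\<phi> p - \<phi> q))) (atin X q)) \<and>
     filterlim (\<lambda>p. E (the p)) at_top (atin (Alexandroff_compactification X) None)"

text \<open>A plane domain carries the complex structure given by the identity chart.\<close>
abbreviation plane_atlas :: "complex set \<Rightarrow> complex chart set" where
  "plane_atlas S \<equiv> {(S, \<lambda>z. z)}"

end

theory Submission
  imports Defs
begin

text \<open>
  Off \<open>0\<close>, \<open>1\<close> and \<open>q\<close> the function equals, up to an additive constant,
  \<open>ln \<bar>p - q\<bar> - k ln \<bar>p\<bar> - m ln \<bar>p - 1\<bar>\<close> (lemma \<open>ln_potential_eq\<close>), and each of the three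
  conditions can be read off from this form.

  Harmonicity: the real differential of this function is \<open>v \<mapsto> Re (F p * v)\<close> for the holomorphic
  function \<open>F p = 1 / (p - q) - k / p - m / (p - 1)\<close>. A function whose differential is of this form
  is harmonic, by the Cauchy--Riemann equations for \<open>F\<close>, and the form is preserved by holomorphic
  changes of coordinate (lemma \<open>surface_harmonic_on_plane\<close>).

  Pole: \<open>ln \<bar>p - q\<bar>\<close> differs from \<open>ln \<bar>\<phi> p - \<phi> q\<bar>\<close> by a function tending to
  \<open>- ln \<bar>\<phi>' q\<bar>\<close>, where \<open>\<phi>' q \<noteq> 0\<close> because a coordinate is injective
  (lemma \<open>local_coordinate_ln_dist_Bfun\<close>); the remaining terms are continuous at \<open>q\<close>.

  Ideal boundary: it is enough that the function tends to \<open>+\<infinity>\<close> at each of \<open>0\<close>, \<open>1\<close> and \<open>\<infinity>\<close>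
  (lemma \<open>filterlim_Alexandroff_punctured_plane\<close>). At the punctures the function tends to
  \<open>+\<infinity>\<close> because \<open>k\<close> and \<open>m\<close> are positive, and at \<open>\<infinity>\<close> because it is
  \<open>(1 - k - m) ln \<bar>p\<bar> + O(1)\<close> with \<open>k + m < 1\<close>.
\<close>

section \<open>Harmonic functions with a holomorphic differential\<close>

text \<open>
  The hypothesis says that \<open>df = Re (F dz)\<close>, that is, \<open>F\<close> is the derivative of \<open>f + i g\<close> for a
  local harmonic conjugate \<open>g\<close> of \<open>f\<close>. Working with \<open>F\<close> avoids choosing branches of the conjugate,
  here of logarithms. The second partial derivatives of \<open>f\<close> are the real parts of \<open>F'\<close>,
  \<open>\<i> F'\<close>, \<open>\<i> F'\<close> and \<open>\<i>\<^sup>2 F' = - F'\<close>.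
\<close>
lemma plane_harmonic_onI:
  assumes "open T" and F: "F holomorphic_on T"
    and f: "\<And>z. z \<in> T \<Longrightarrow> (f has_derivative (\<lambda>v. Re (F z * v))) (at z)"
  shows "plane_harmonic_on f T"
proof -
  have dF: "(F has_field_derivative deriv F z) (at z)" if "z \<in> T" for z
    using F \<open>open T\<close> that by (rule holomorphic_derivI)
  have contF': "continuous_on T (deriv F)"
    using F \<open>open T\<close> by (intro holomorphic_on_imp_continuous_on holomorphic_deriv)
  have partials: "has_partials_on g (\<lambda>z. Re (G z)) (\<lambda>z. Re (\<i> * G z)) T"
    if g: "\<And>z. z \<in> T \<Longrightarrow> (g has_derivative (\<lambda>v. Re (G z * v))) (at z)" for g G
    unfolding has_partials_on_def
  proof (intro ballI)
    fix z assume "z \<in> T"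
    have dir: "((\<lambda>t. g (z + u * complex_of_real t)) has_real_derivative Re (u * G z)) (at 0)" for u
    proof -
      have "((\<lambda>t. z + u * complex_of_real t) has_derivative (\<lambda>t. u * complex_of_real t)) (at 0)"
        by (auto intro!: derivative_eq_intros)
      moreover have "(g has_derivative (\<lambda>v. Re (G z * v))) (at (z + u * complex_of_real 0))"
        using g[OF \<open>z \<in> T\<close>] by simp
      ultimately have "((\<lambda>t. g (z + u * complex_of_real t)) has_derivative
          (\<lambda>t. Re (G z * (u * complex_of_real t)))) (at 0)"
        by (rule has_derivative_compose)
      moreover have "(\<lambda>t. Re (G z * (u * complex_of_real t))) = (*) (Re (u * G z))"
        by (auto simp: algebra_simps)
      ultimately show ?thesis
        by (simp add: has_field_derivative_def)
    qed
    show "((\<lambda>t. g (z + complex_of_real t)) has_real_derivative Re (G z)) (at 0) \<and>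
      ((\<lambda>t. g (z + \<i> * complex_of_real t)) has_real_derivative Re (\<i> * G z)) (at 0)"
      using dir[of 1] dir[of \<i>] by simp
  qed
  have 1: "has_partials_on f (\<lambda>z. Re (F z)) (\<lambda>z. Re (\<i> * F z)) T"
    by (rule partials) (rule f)
  have 2: "has_partials_on (\<lambda>z. Re (F z)) (\<lambda>z. Re (deriv F z)) (\<lambda>z. Re (\<i> * deriv F z)) T"
    by (rule partials) (rule has_derivative_Re[OF dF[unfolded has_field_derivative_def]])
  have 3: "has_partials_on (\<lambda>z. Re (\<i> * F z)) (\<lambda>z. Re (\<i> * deriv F z))
      (\<lambda>z. Re (\<i> * (\<i> * deriv F z))) T"
    by (rule partials) (rule has_derivative_Re[OF DERIV_cmult[OF dF, unfolded has_field_derivative_def]])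
  have 4: "continuous_on T (\<lambda>z. Re (c * deriv F z))" for c
    by (intro continuous_on_Re continuous_on_mult continuous_on_const contF')
  have 5: "continuous_on T (\<lambda>z. Re (deriv F z))"
    using 4[of 1] by simp
  have 6: "continuous_on T (\<lambda>z. Re (\<i> * (\<i> * deriv F z)))"
    using 4[of "\<i> * \<i>"] by (simp only: mult.assoc)
  have 7: "\<forall>z\<in>T. Re (deriv F z) + Re (\<i> * (\<i> * deriv F z)) = 0"
    by simp
  show ?thesis
    unfolding plane_harmonic_on_def using \<open>open T\<close> 1 2 3 4 5 6 7 by blast
qed

lemma has_derivative_ln_cmod_diff:
  assumes "z \<noteq> a"
  shows "((\<lambda>z. ln (cmod (z - a))) has_derivative (\<lambda>v. Re (v / (z - a)))) (at z)"
proof -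
  have inner_eq: "inner v (sgn w) * inverse (cmod w) = Re (v / w)" for v w
  proof -
    have "inner v (sgn w) * inverse (cmod w) = inner v w / (cmod w)\<^sup>2"
      by (simp add: sgn_div_norm power2_eq_square divide_inverse)
    also have "\<dots> = Re (v / w)"
      by (subst complex_div_cnj) (simp add: inner_complex_def flip: of_real_power)
    finally show ?thesis .
  qed
  have "((\<lambda>z. z - a) has_derivative (\<lambda>v. v)) (at z)"
    by (auto intro!: derivative_eq_intros)
  then have "((\<lambda>z. cmod (z - a)) has_derivative (\<lambda>v. inner v (sgn (z - a)))) (at z)"
    by (rule has_derivative_compose) (use assms in \<open>simp add: has_derivative_norm\<close>)
  then have "((\<lambda>z. ln (cmod (z - a))) has_derivative
      (\<lambda>v. inner v (sgn (z - a)) * inverse (cmod (z - a)))) (at z)"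
    by (rule has_derivative_ln[rotated]) (use assms in simp)
  then show ?thesis
    by (simp only: inner_eq)
qed

section \<open>Local coordinates of plane domains\<close>

lemma local_coordinate_plane:
  assumes "open S" and c: "local_coordinate (top_of_set S) (plane_atlas S) (U, \<phi>)"
  shows "open U" and "U \<subseteq> S" and "open (\<phi> ` U)" and "inj_on \<phi> U"
    and "\<phi> holomorphic_on U" and "the_inv_into U \<phi> holomorphic_on \<phi> ` U"
proof -
  have chart: "is_chart (top_of_set S) (U, \<phi>)"
    and comp: "compatible_charts (U, \<phi>) (S, \<lambda>z. z)"
    using c by (auto simp: local_coordinate_def)
  show US: "U \<subseteq> S" and "open U"
    using chart \<open>open S\<close> by (auto simp: is_chart_def openin_open_eq)
  show "open (\<phi> ` U)" and "inj_on \<phi> U"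
    using chart US by (auto simp: is_chart_def homeomorphic_eq_everything_map subtopology_subtopology
        inf.absorb2)
  have "U \<inter> S = U"
    using US by auto
  with comp have fwd: "(\<phi> \<circ> the_inv_into S (\<lambda>z. z)) holomorphic_on U"
    and bwd: "((\<lambda>z. z) \<circ> the_inv_into U \<phi>) holomorphic_on \<phi> ` U"
    by (auto simp: compatible_charts_def)
  show "the_inv_into U \<phi> holomorphic_on \<phi> ` U"
    using bwd by (simp add: o_def)
  have "the_inv_into S (\<lambda>z. z) z = z" if "z \<in> U" for z
    using that US by (intro the_inv_into_f_eq) auto
  then show "\<phi> holomorphic_on U"
    by (intro holomorphic_transform[OF fwd]) auto
qed

lemma surface_harmonic_on_plane:
  assumes "open S" "open W" "W \<subseteq> S" and F: "F holomorphic_on W"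
    and f: "\<And>z. z \<in> W \<Longrightarrow> (f has_derivative (\<lambda>v. Re (F z * v))) (at z)"
  shows "surface_harmonic_on (top_of_set S) (plane_atlas S) f W"
  unfolding surface_harmonic_on_def
proof (intro conjI allI impI)
  show "openin (top_of_set S) W"
    using assms by (simp add: openin_open_eq)
  fix U \<phi> assume c: "local_coordinate (top_of_set S) (plane_atlas S) (U, \<phi>)"
  note lc = local_coordinate_plane[OF \<open>open S\<close> c]
  define g where "g = the_inv_into U \<phi>"
  define T where "T = \<phi> ` (U \<inter> W)"
  have "U \<inter> W \<subseteq> U"
    by auto
  have "open T"
    unfolding T_def
  proof (rule open_mapping_thm3)
    show "\<phi> holomorphic_on U \<inter> W" "open (U \<inter> W)" "inj_on \<phi> (U \<inter> W)"
      using lc \<open>open W\<close> by (auto intro: holomorphic_on_subset inj_on_subset)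
  qed
  have gT: "g ` T \<subseteq> W"
    using lc(4) by (auto simp: g_def T_def the_inv_into_f_f)
  have holg: "g holomorphic_on T"
    using lc(6) by (auto simp: g_def T_def intro: holomorphic_on_subset)
  show "plane_harmonic_on (f \<circ> the_inv_into U \<phi>) (\<phi> ` (U \<inter> W))"
    unfolding T_def[symmetric] g_def[symmetric]
  proof (rule plane_harmonic_onI[where F = "\<lambda>z. F (g z) * deriv g z"])
    show "open T"
      by fact
    show "(\<lambda>z. F (g z) * deriv g z) holomorphic_on T"
      using holomorphic_on_compose_gen[OF holg F] gT holg \<open>open T\<close>
      by (auto simp: o_def image_subset_iff intro!: holomorphic_intros holomorphic_deriv)
    fix z assume "z \<in> T"
    have "(g has_derivative (*) (deriv g z)) (at z)"
      using holomorphic_derivI[OF holg \<open>open T\<close> \<open>z \<in> T\<close>] by (simp add: has_field_derivative_def)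
    moreover have "(f has_derivative (\<lambda>v. Re (F (g z) * v))) (at (g z))"
      using gT \<open>z \<in> T\<close> by (intro f) auto
    ultimately show "(f \<circ> g has_derivative (\<lambda>v. Re (F (g z) * deriv g z * v))) (at z)"
      unfolding o_def mult.assoc by (rule has_derivative_compose)
  qed
qed

lemma tendsto_imp_Bfun:
  fixes f :: "'a \<Rightarrow> 'b :: real_normed_vector"
  assumes "(f \<longlongrightarrow> c) F"
  shows "Bfun f F"
proof (rule BfunI)
  show "\<forall>\<^sub>F x in F. norm (f x) \<le> norm c + 1"
    using order_tendstoD(2)[OF tendsto_norm[OF assms], of "norm c + 1"]
    by (auto elim: eventually_mono)
qed

lemma atin_top_of_set_open:
  assumes "open S" and "q \<in> S"
  shows "atin (top_of_set S) q = at q"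
proof -
  have "(\<exists>U. open U \<and> U \<subseteq> S \<and> q \<in> U \<and> (\<forall>x\<in>U - {q}. P x)) \<longleftrightarrow>
      (\<exists>U. open U \<and> q \<in> U \<and> (\<forall>x\<in>U. x \<noteq> q \<longrightarrow> P x))" (is "?L \<longleftrightarrow> ?R") for P
  proof
    assume ?R
    then obtain U where "open U" "q \<in> U" "\<forall>x\<in>U. x \<noteq> q \<longrightarrow> P x"
      by auto
    then show ?L
      using assms by (intro exI[of _ "U \<inter> S"]) auto
  qed auto
  then show ?thesis
    using assms
    by (simp add: filter_eq_iff eventually_atin eventually_at_topological openin_open_eq conj_assoc)
qed

lemma local_coordinate_ln_dist_Bfun:
  assumes "open S" and c: "local_coordinate (top_of_set S) (plane_atlas S) (U, \<phi>)" and "q \<in> U"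
  shows "Bfun (\<lambda>p. ln (cmod (p - q)) - ln (cmod (\<phi> p - \<phi> q))) (at q)"
proof -
  note lc = local_coordinate_plane[OF \<open>open S\<close> c]
  have d0: "deriv \<phi> q \<noteq> 0"
    using holomorphic_injective_imp_regular[OF lc(5,1,4) \<open>q \<in> U\<close>] .
  \<comment> \<open>The difference of logarithms is minus the logarithm of the difference quotient of \<open>\<phi>\<close>.\<close>
  have "((\<lambda>p. (\<phi> p - \<phi> q) / (p - q)) \<longlongrightarrow> deriv \<phi> q) (at q)"
    using holomorphic_derivI[OF lc(5,1) \<open>q \<in> U\<close>] by (simp add: has_field_derivative_iff)
  then have "((\<lambda>p. - ln (cmod ((\<phi> p - \<phi> q) / (p - q)))) \<longlongrightarrow> - ln (cmod (deriv \<phi> q))) (at q)"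
    using d0 by (intro tendsto_intros) auto
  moreover have "\<forall>\<^sub>F p in at q. p \<in> U - {q}"
    using lc(1) \<open>q \<in> U\<close> by (auto simp: eventually_at_topological)
  then have "\<forall>\<^sub>F p in at q. - ln (cmod ((\<phi> p - \<phi> q) / (p - q))) =
      ln (cmod (p - q)) - ln (cmod (\<phi> p - \<phi> q))"
  proof eventually_elim
    case (elim p)
    then have "\<phi> p \<noteq> \<phi> q"
      using lc(4) \<open>q \<in> U\<close> by (auto dest: inj_onD)
    with elim show ?case
      by (simp add: norm_divide ln_div)
  qed
  ultimately have "((\<lambda>p. ln (cmod (p - q)) - ln (cmod (\<phi> p - \<phi> q))) \<longlongrightarrow> - ln (cmod (deriv \<phi> q))) (at q)"
    by (rule Lim_transform_eventually)
  then show ?thesis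
    by (rule tendsto_imp_Bfun)
qed

section \<open>Finitely punctured planes\<close>

lemma open_riemann_surface_punctured_plane:
  fixes P :: "complex set"
  assumes "finite P"
  shows "open_riemann_surface (top_of_set (UNIV - P)) (plane_atlas (UNIV - P))"
proof -
  let ?S = "UNIV - P"
  have "open ?S"
    using assms by (simp add: finite_imp_closed open_Diff)
  have "connected ?S"
    using assms by (intro connected_open_delete_finite) auto
  have "\<not> bounded ?S"
    using assms bounded_Un[of ?S P] finite_imp_bounded[of P] not_bounded_UNIV[where 'a = complex]
    by (auto simp: Un_commute)
  then have "\<not> compact ?S" and "?S \<noteq> {}"
    using compact_imp_bounded[of ?S] bounded_empty by (blast, metis)
  moreover have "holomorphic_atlas (top_of_set ?S) (plane_atlas ?S)"
  proof -
    have "(the_inv_into ?S (\<lambda>z. z)) holomorphic_on ?S"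
      by (rule holomorphic_transform[OF holomorphic_on_ident]) (auto intro!: the_inv_into_f_eq[symmetric])
    then show ?thesis
      using \<open>open ?S\<close> homeomorphic_map_id[of "top_of_set ?S" "top_of_set ?S"]
      by (auto simp: holomorphic_atlas_def is_chart_def compatible_charts_def o_def id_def
          subtopology_subtopology)
  qed
  ultimately show ?thesis
    using \<open>connected ?S\<close> Hausdorff_space_subtopology[OF Hausdorff_space_euclidean, of ?S]
    by (auto simp: open_riemann_surface_def riemann_surface_def connected_space_subtopology
        compact_space_def compactin_subtopology)
qed

text \<open>
  No condition is needed at the points of \<open>P\<close> themselves, since the filters \<open>at a\<close> are punctured.
\<close>
lemma filterlim_Alexandroff_punctured_plane:
  fixes P :: "complex set" and f :: "complex \<Rightarrow> real"
  assumes "finite P" and P: "\<And>a. a \<in> P \<Longrightarrow> filterlim f at_top (at a)"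
    and inf: "filterlim f at_top at_infinity"
  shows "filterlim (\<lambda>p. f (the p)) at_top
    (atin (Alexandroff_compactification (top_of_set (UNIV - P))) None)"
  unfolding filterlim_at_top
proof
  fix Z :: real
  have "\<exists>V. open V \<and> a \<in> V \<and> (\<forall>x\<in>V. x \<noteq> a \<longrightarrow> Z \<le> f x)" if "a \<in> P" for a
    using P[OF that] by (auto simp: filterlim_at_top eventually_at_topological)
  then obtain V where V: "\<And>a. a \<in> P \<Longrightarrow> open (V a) \<and> a \<in> V a \<and> (\<forall>x\<in>V a. x \<noteq> a \<longrightarrow> Z \<le> f x)"
    by metis
  obtain R where R: "\<And>x. R \<le> cmod x \<Longrightarrow> Z \<le> f x"
    using inf by (auto simp: filterlim_at_top eventually_at_infinity)
  \<comment> \<open>The neighbourhood of the ideal boundary point is the complement of this compact set.\<close>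
  define K where "K = cball 0 R - (\<Union>a\<in>P. V a)"
  have "compact K"
    unfolding K_def using V by (intro compact_diff) auto
  have KS: "K \<subseteq> UNIV - P"
    using V by (auto simp: K_def)
  have large: "Z \<le> f x" if "x \<notin> P" "x \<notin> K" for x
  proof (cases "R \<le> cmod x")
    case False
    with that obtain a where "a \<in> P" "x \<in> V a"
      by (auto simp: K_def)
    with that V[of a] show ?thesis
      by auto
  qed (rule R)
  let ?X = "top_of_set (UNIV - P)"
  let ?N = "insert None (Some ` (topspace ?X - K))"
  have "compactin ?X K" "closedin ?X K"
    using \<open>compact K\<close> KS by (auto simp: compactin_subtopology closed_subset compact_imp_closed)
  then have "openin (Alexandroff_compactification ?X) ?N"
    unfolding openin_Alexandroff_compactification by blast
  moreover have "\<forall>x\<in>?N - {None}. Z \<le> f (the x)"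
    using large by auto
  ultimately show "\<forall>\<^sub>F p in atin (Alexandroff_compactification ?X) None. Z \<le> f (the p)"
    unfolding eventually_atin by (intro disjI2 exI[of _ ?N]) auto
qed

section \<open>The potential on the twice punctured plane\<close>

lemma ln_potential_eq:
  fixes p q :: complex
  assumes "p \<notin> {0, 1, q}" and "q \<notin> {0, 1}"
  shows "ln (cmod (p - q) / (cmod p powr k * cmod q powr l * cmod (p - 1) powr m * cmod (q - 1) powr n))
    = ln (cmod (p - q)) - k * ln (cmod p) - m * ln (cmod (p - 1))
      - (l * ln (cmod q) + n * ln (cmod (q - 1)))"
  using assms by (simp add: ln_div ln_mult ln_powr)

lemma filterlim_ln_cmod_diff_at_bot: "filterlim (\<lambda>p. ln (cmod (p - a))) at_bot (at a)"
proof -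
  have "filterlim (\<lambda>p. cmod (p - a)) (at_right 0) (at a)"
    unfolding filterlim_at
    by (auto intro!: tendsto_eq_intros simp: eventually_at_filter)
  then show ?thesis
    by (rule filterlim_compose[OF ln_at_0])
qed

lemma tendsto_ln_cmod_diff_at_infinity:
  "((\<lambda>p. ln (cmod (p - a)) - ln (cmod p)) \<longlongrightarrow> 0) at_infinity"
proof -
  have "((\<lambda>p. 1 - a * inverse p) \<longlongrightarrow> 1 - a * 0) at_infinity"
    by (intro tendsto_intros tendsto_inverse_0)
  then have "((\<lambda>p. ln (cmod (1 - a * inverse p))) \<longlongrightarrow> ln (cmod (1 - a * 0))) at_infinity"
    by (intro tendsto_ln tendsto_norm) auto
  moreover have "\<forall>\<^sub>F p in at_infinity. p \<noteq> 0 \<and> p \<noteq> a"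
    by (intro eventually_conj eventually_not_equal_at_infinity)
  then have "\<forall>\<^sub>F p in at_infinity. ln (cmod (1 - a * inverse p)) = ln (cmod (p - a)) - ln (cmod p)"
  proof eventually_elim
    case (elim p)
    then have "1 - a * inverse p = (p - a) / p"
      by (simp add: field_simps)
    with elim show ?case
      by (simp add: norm_divide ln_div)
  qed
  ultimately show ?thesis
    using Lim_transform_eventually by fastforce
qed

theorem theorem1p5:
  fixes k l m n :: real and q :: complex
  assumes "k > 0" and "l > 0" and "m > 0" and "n > 0"
    and "k + m < 1" and "l + n < 1"
    and "q \<in> UNIV - {0, 1}"
  shows "evans_selberg_potential (top_of_set (UNIV - {0, 1})) (plane_atlas (UNIV - {0, 1})) q
    (\<lambda>p. ln (cmod (p - q) /
      (cmod p powr k * cmod q powr l * cmod (p - 1) powr m * cmod (q - 1) powr n)))"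
proof -
  let ?S = "UNIV - {0, 1} :: complex set"
  define E where "E = (\<lambda>p. ln (cmod (p - q) /
      (cmod p powr k * cmod q powr l * cmod (p - 1) powr m * cmod (q - 1) powr n)))"
  define C where "C = l * ln (cmod q) + n * ln (cmod (q - 1))"
  have q: "q \<noteq> 0" "q \<noteq> 1"
    using assms by auto
  have "open ?S"
    by (simp add: finite_imp_closed open_Diff)
  have E_eq: "E p = ln (cmod (p - q)) - k * ln (cmod p) - m * ln (cmod (p - 1)) - C"
    if "p \<notin> {0, 1, q}" for p
    unfolding E_def C_def using that q by (intro ln_potential_eq) auto
  have E_at: "\<forall>\<^sub>F p in at a. ln (cmod (p - q)) - k * ln (cmod p) - m * ln (cmod (p - 1)) - C = E p" for a
  proof -
    have "\<forall>\<^sub>F p in at a. p \<notin> {0, 1, q}"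
      by (auto intro!: eventually_conj eventually_neq_at_within)
    then show ?thesis
      by eventually_elim (simp add: E_eq)
  qed

  have "surface_harmonic_on (top_of_set ?S) (plane_atlas ?S) E (?S - {q})"
  proof (rule surface_harmonic_on_plane)
    show "open ?S" "open (?S - {q})" "?S - {q} \<subseteq> ?S"
      using \<open>open ?S\<close> by (auto simp: open_delete)
    show "(\<lambda>p. 1 / (p - q) - of_real k / p - of_real m / (p - 1)) holomorphic_on (?S - {q})"
      by (auto intro!: holomorphic_intros)
    fix z assume z: "z \<in> ?S - {q}"
    have "((\<lambda>p. ln (cmod (p - q)) - k * ln (cmod (p - 0)) - m * ln (cmod (p - 1)) - C) has_derivative
        (\<lambda>v. Re (v / (z - q)) - k * Re (v / (z - 0)) - m * Re (v / (z - 1)) - 0)) (at z)"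
      using z by (intro derivative_intros has_derivative_ln_cmod_diff) auto
    moreover have "(\<lambda>v. Re (v / (z - q)) - k * Re (v / (z - 0)) - m * Re (v / (z - 1)) - 0) =
        (\<lambda>v. Re ((1 / (z - q) - of_real k / z - of_real m / (z - 1)) * v))"
    proof
      fix v
      have "(1 / (z - q) - of_real k / z - of_real m / (z - 1)) * v =
          v / (z - q) - of_real k * (v / z) - of_real m * (v / (z - 1))"
        by (simp add: algebra_simps)
      then show "Re (v / (z - q)) - k * Re (v / (z - 0)) - m * Re (v / (z - 1)) - 0 =
          Re ((1 / (z - q) - of_real k / z - of_real m / (z - 1)) * v)"
        by (simp only: minus_complex.sel Re_complex_of_real times_complex.sel
            Im_complex_of_real) simp
    qed
    ultimately have "((\<lambda>p. ln (cmod (p - q)) - k * ln (cmod (p - 0)) - m * ln (cmod (p - 1)) - C)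
        has_derivative (\<lambda>v. Re ((1 / (z - q) - of_real k / z - of_real m / (z - 1)) * v))) (at z)"
      by simp
    then show "(E has_derivative (\<lambda>v. Re ((1 / (z - q) - of_real k / z - of_real m / (z - 1)) * v))) (at z)"
      by (rule has_derivative_transform_within_open[OF _ \<open>open (?S - {q})\<close> z]) (simp add: E_eq)
  qed

  moreover have "Bfun (\<lambda>p. E p - ln (cmod (\<phi> p - \<phi> q))) (atin (top_of_set ?S) q)"
    if c: "local_coordinate (top_of_set ?S) (plane_atlas ?S) (U, \<phi>)" and qU: "q \<in> U" for U \<phi>
  proof -
    have atin: "atin (top_of_set ?S) q = at q"
      using \<open>open ?S\<close> q by (intro atin_top_of_set_open) auto
    have "((\<lambda>p. - k * ln (cmod p) - m * ln (cmod (p - 1)) - C) \<longlongrightarrow>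
        - k * ln (cmod q) - m * ln (cmod (q - 1)) - C) (at q)"
      using q by (intro tendsto_intros) auto
    then have "Bfun (\<lambda>p. - k * ln (cmod p) - m * ln (cmod (p - 1)) - C) (at q)"
      by (rule tendsto_imp_Bfun)
    then obtain A where "\<forall>\<^sub>F p in at q. norm (- k * ln (cmod p) - m * ln (cmod (p - 1)) - C) \<le> A"
      by (auto elim: BfunE)
    moreover obtain B where "\<forall>\<^sub>F p in at q. norm (ln (cmod (p - q)) - ln (cmod (\<phi> p - \<phi> q))) \<le> B"
      using local_coordinate_ln_dist_Bfun[OF \<open>open ?S\<close> c qU] by (auto elim: BfunE)
    ultimately have "\<forall>\<^sub>F p in at q. norm (E p - ln (cmod (\<phi> p - \<phi> q))) \<le> A + B"
      using E_at[of q] by eventually_elim (unfold real_norm_def, linarith)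
    then show ?thesis
      unfolding atin by (rule BfunI)
  qed

  moreover have "filterlim (\<lambda>p. E (the p)) at_top (atin (Alexandroff_compactification (top_of_set ?S)) None)"
  proof (rule filterlim_Alexandroff_punctured_plane)
    show "finite {0, 1 :: complex}"
      by simp
    fix a :: complex assume "a \<in> {0, 1}"
    then consider "a = 0" | "a = 1"
      by auto
    then show "filterlim E at_top (at a)"
    proof cases
      case 1
      have "((\<lambda>p. ln (cmod (p - q)) - m * ln (cmod (p - 1)) - C) \<longlongrightarrow>
          ln (cmod (0 - q)) - m * ln (cmod (0 - 1)) - C) (at 0)"
        using q by (intro tendsto_intros) auto
      moreover have "filterlim (\<lambda>p. k * - ln (cmod (p - 0))) at_top (at 0)"
        using \<open>k > 0\<close> filterlim_ln_cmod_diff_at_bot[of 0]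
        by (intro filterlim_tendsto_pos_mult_at_top[OF tendsto_const])
          (auto simp: filterlim_uminus_at_bot)
      ultimately have "filterlim (\<lambda>p. ln (cmod (p - q)) - m * ln (cmod (p - 1)) - C +
          k * - ln (cmod (p - 0))) at_top (at 0)"
        by (rule filterlim_tendsto_add_at_top)
      then show ?thesis
        unfolding 1 by (rule filterlim_mono_eventually[OF _ order_refl order_refl])
          (use E_at[of 0] in \<open>auto simp: algebra_simps elim: eventually_mono\<close>)
    next
      case 2
      have "((\<lambda>p. ln (cmod (p - q)) - k * ln (cmod p) - C) \<longlongrightarrow>
          ln (cmod (1 - q)) - k * ln (cmod 1) - C) (at 1)"
        using q by (intro tendsto_intros) auto
      moreover have "filterlim (\<lambda>p. m * - ln (cmod (p - 1))) at_top (at 1)"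
        using \<open>m > 0\<close> filterlim_ln_cmod_diff_at_bot[of 1]
        by (intro filterlim_tendsto_pos_mult_at_top[OF tendsto_const])
          (auto simp: filterlim_uminus_at_bot)
      ultimately have "filterlim (\<lambda>p. ln (cmod (p - q)) - k * ln (cmod p) - C +
          m * - ln (cmod (p - 1))) at_top (at 1)"
        by (rule filterlim_tendsto_add_at_top)
      then show ?thesis
        unfolding 2 by (rule filterlim_mono_eventually[OF _ order_refl order_refl])
          (use E_at[of 1] in \<open>auto simp: algebra_simps elim: eventually_mono\<close>)
    qed
  next
    \<comment> \<open>Comparing each logarithm with \<open>ln \<bar>p\<bar>\<close> isolates the growth \<open>(1 - k - m) ln \<bar>p\<bar>\<close>.\<close>
    let ?d = "\<lambda>a p. ln (cmod (p - a)) - ln (cmod p)"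
    have "((\<lambda>p. ?d q p - m * ?d 1 p - C) \<longlongrightarrow> 0 - m * 0 - C) at_infinity"
      by (intro tendsto_intros tendsto_ln_cmod_diff_at_infinity)
    moreover have "filterlim (\<lambda>p :: complex. (1 - k - m) * ln (cmod p)) at_top at_infinity"
      using \<open>k + m < 1\<close>
      by (intro filterlim_tendsto_pos_mult_at_top[OF tendsto_const]
          filterlim_compose[OF ln_at_top filterlim_norm_at_top]) auto
    ultimately have "filterlim (\<lambda>p. ?d q p - m * ?d 1 p - C + (1 - k - m) * ln (cmod p)) at_top at_infinity"
      by (rule filterlim_tendsto_add_at_top)
    moreover have "\<forall>\<^sub>F p in at_infinity. p \<notin> {0, 1, q}"
      by (auto intro!: eventually_conj eventually_not_equal_at_infinity)
    then have "\<forall>\<^sub>F p in at_infinity. ?d q p - m * ?d 1 p - C + (1 - k - m) * ln (cmod p) = E p"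
      by eventually_elim (simp add: E_eq algebra_simps)
    ultimately show "filterlim E at_top at_infinity"
      by (rule filterlim_mono_eventually[OF _ order_refl order_refl])
  qed

  ultimately show ?thesis
    unfolding evans_selberg_potential_def E_def[symmetric]
    using open_riemann_surface_punctured_plane[of "{0, 1}"] q by auto
qed

end
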